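(* Let $X$ be a Banach space, $E\subset X$ a nonempty closed convex subset, and $T:E\to E$ a contractive-like mapping, i.e. there exist a constant $\delta\in[0,1)$ and a strictly increasing continuous function $\varphi:[0,\infty)\to[0,\infty)$ with $\varphi(0)=0$ such that $$\|Tx-Ty\|\le \delta\|x-y\|+\varphi(\|x-Tx\|)\qquad\text{for all }x,y\in E.$$ Suppose the set of fixed points $F_T=\{p: p=Tp\}$ is nonempty and let $p\in F_T$. Let $k\ge2$ be an integer, let $\{\alpha_n\}_{n\ge0}$, $\{\beta_n\}_{n\ge0}$ and $\{\beta_n^i\}_{n\ge0}$ ($i\ge 1$) be real sequences in $[0,1)$, and let $\lambda\in(0,1)$. Assume that there is a constant $A$ with $\alpha_n\ge A>0$ for all $n\in\mathbb{N}$. If the initial point $x_0\in E$ is the same for all the iterations below (each formed with these parameters), then the following are equivalent: (1) the Picard iteration converges to $p$; (2) the Krasnoselskij iteration converges to $p$; (3) the Mann iteration converges to $p$; (4) the Ishikawa iteration converges to $p$; (5) the new two-step iteration converges to $p$; (6) the Noor iteration converges to $p$; (7) the SP iteration converges to $p$; (8) the multistep iteration converges to $p$; (9) the new multistep iteration converges to $p$; (10) the S-iteration converges to $p$.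
   Context: $\mathbb{N}$ denotes the set of all nonnegative integers. Convergence is in the norm of $X$. Each iteration starts from $x_0\in E$ and is defined for $n\in\mathbb{N}$ as follows. Picard: $x_{n+1}=Tx_n$. Krasnoselskij: $x_{n+1}=(1-\lambda)x_n+\lambda Tx_n$. Mann: $x_{n+1}=(1-\alpha_n)x_n+\alpha_nTx_n$. Multistep (with $k\ge2$): $x_{n+1}=(1-\alpha_n)x_n+\alpha_nTy_n^1$; $y_n^i=(1-\beta_n^i)x_n+\beta_n^iTy_n^{i+1}$ for $i=1,\dots,k-2$; $y_n^{k-1}=(1-\beta_n^{k-1})x_n+\beta_n^{k-1}Tx_n$. (For $k=2$ the middle relation is void.) Ishikawa: the multistep iteration with $k=2$, i.e. $x_{n+1}=(1-\alpha_n)x_n+\alpha_nTy_n^1$, $y_n^1=(1-\beta_n^1)x_n+\beta_n^1Tx_n$. Noor: the multistep iteration with $k=3$, i.e. $x_{n+1}=(1-\alpha_n)x_n+\alpha_nTy_n^1$, $y_n^1=(1-\beta_n^1)x_n+\beta_n^1Ty_n^2$, $y_n^2=(1-\beta_n^2)x_n+\beta_n^2Tx_n$. New multistep (with $k\ge2$): $x_{n+1}=(1-\alpha_n)y_n^1+\alpha_nTy_n^1$; $y_n^i=(1-\beta_n^i)y_n^{i+1}+\beta_n^iTy_n^{i+1}$ for $i=1,\dots,k-2$; $y_n^{k-1}=(1-\beta_n^{k-1})x_n+\beta_n^{k-1}Tx_n$. (For $k=2$ the middle relation is void.) New two-step: the new multistep iteration with $k=2$, i.e. $x_{n+1}=(1-\alpha_n)y_n^1+\alpha_nTy_n^1$,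 $y_n^1=(1-\beta_n^1)x_n+\beta_n^1Tx_n$. SP: the new multistep iteration with $k=3$, i.e. $x_{n+1}=(1-\alpha_n)y_n^1+\alpha_nTy_n^1$, $y_n^1=(1-\beta_n^1)y_n^2+\beta_n^1Ty_n^2$, $y_n^2=(1-\beta_n^2)x_n+\beta_n^2Tx_n$. S-iteration: $x_{n+1}=(1-\alpha_n)Tx_n+\alpha_nTy_n$, $y_n=(1-\beta_n)x_n+\beta_nTx_n$. *)

theory Defs
  imports "HOL-Analysis.Analysis"
begin

definition contractive_like_on :: "'a::real_normed_vector set \<Rightarrow> ('a \<Rightarrow> 'a) \<Rightarrow> bool" where
  "contractive_like_on E T \<longleftrightarrow>
     (\<exists>(\<delta>::real) (\<phi>::real \<Rightarrow> real). \<delta> \<in> {0..<1} \<and>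
        \<phi> \<in> {0..} \<rightarrow> {0..} \<and> strict_mono_on {0..} \<phi> \<and> continuous_on {0..} \<phi> \<and> \<phi> 0 = 0 \<and>
        (\<forall>x\<in>E. \<forall>y\<in>E. norm (T x - T y) \<le> \<delta> * norm (x - y) + \<phi> (norm (x - T x))))"

definition fixed_points :: "'a set \<Rightarrow> ('a \<Rightarrow> 'a) \<Rightarrow> 'a set" where
  "fixed_points E T = {p \<in> E. p = T p}"

primrec picard :: "('a \<Rightarrow> 'a) \<Rightarrow> 'a \<Rightarrow> nat \<Rightarrow> 'a" where
  "picard T x0 0 = x0"
| "picard T x0 (Suc n) = T (picard T x0 n)"

primrec krasnoselskij ::
  "('a::real_vector \<Rightarrow> 'a) \<Rightarrow> real \<Rightarrow> 'a \<Rightarrow> nat \<Rightarrow> 'a" where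
  "krasnoselskij T l x0 0 = x0"
| "krasnoselskij T l x0 (Suc n) =
     (1 - l) *\<^sub>R krasnoselskij T l x0 n + l *\<^sub>R T (krasnoselskij T l x0 n)"

primrec mann ::
  "('a::real_vector \<Rightarrow> 'a) \<Rightarrow> (nat \<Rightarrow> real) \<Rightarrow> 'a \<Rightarrow> nat \<Rightarrow> 'a" where
  "mann T \<alpha> x0 0 = x0"
| "mann T \<alpha> x0 (Suc n) = (1 - \<alpha> n) *\<^sub>R mann T \<alpha> x0 n + \<alpha> n *\<^sub>R T (mann T \<alpha> x0 n)"

text \<open>For both multistep schemes, the inner point with superscript \<open>i\<close> at stage \<open>n\<close> is computed
  from \<open>x\<close> (the iterate at stage \<open>n\<close>) and \<open>b i\<close> (the coefficient with superscript \<open>i\<close> at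
  stage \<open>n\<close>), by downward recursion on \<open>i\<close> starting at \<open>i = k - 1\<close>. Only \<open>1 \<le> i \<le> k - 1\<close> is
  meaningful. Families of sequences are written \<open>\<beta> i n\<close>, superscript first.\<close>

function multistep_inner ::
  "('a::real_vector \<Rightarrow> 'a) \<Rightarrow> nat \<Rightarrow> (nat \<Rightarrow> real) \<Rightarrow> 'a \<Rightarrow> nat \<Rightarrow> 'a" where
  "multistep_inner T k b x i =
     (if i < k - 1 then (1 - b i) *\<^sub>R x + b i *\<^sub>R T (multistep_inner T k b x (i + 1))
      else (1 - b i) *\<^sub>R x + b i *\<^sub>R T x)"
  by pat_completeness auto
termination
  by (relation "Wellfounded.measure (\<lambda>(T, k, b, x, i). k - i)") auto

function new_multistep_inner ::
  "('a::real_vector \<Rightarrow> 'a) \<Rightarrow> nat \<Rightarrow> (nat \<Rightarrow> real) \<Rightarrow> 'a \<Rightarrow> nat \<Rightarrow> 'a" where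
  "new_multistep_inner T k b x i =
     (if i < k - 1 then (1 - b i) *\<^sub>R new_multistep_inner T k b x (i + 1)
                        + b i *\<^sub>R T (new_multistep_inner T k b x (i + 1))
      else (1 - b i) *\<^sub>R x + b i *\<^sub>R T x)"
  by pat_completeness auto
termination
  by (relation "Wellfounded.measure (\<lambda>(T, k, b, x, i). k - i)") auto

declare multistep_inner.simps [simp del] new_multistep_inner.simps [simp del]

primrec multistep ::
  "('a::real_vector \<Rightarrow> 'a) \<Rightarrow> nat \<Rightarrow> (nat \<Rightarrow> real) \<Rightarrow> (nat \<Rightarrow> nat \<Rightarrow> real) \<Rightarrow> 'a \<Rightarrow> nat \<Rightarrow> 'a" where
  "multistep T k \<alpha> \<beta> x0 0 = x0"
| "multistep T k \<alpha> \<beta> x0 (Suc n) =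
     (1 - \<alpha> n) *\<^sub>R multistep T k \<alpha> \<beta> x0 n
     + \<alpha> n *\<^sub>R T (multistep_inner T k (\<lambda>i. \<beta> i n) (multistep T k \<alpha> \<beta> x0 n) 1)"

primrec new_multistep ::
  "('a::real_vector \<Rightarrow> 'a) \<Rightarrow> nat \<Rightarrow> (nat \<Rightarrow> real) \<Rightarrow> (nat \<Rightarrow> nat \<Rightarrow> real) \<Rightarrow> 'a \<Rightarrow> nat \<Rightarrow> 'a" where
  "new_multistep T k \<alpha> \<beta> x0 0 = x0"
| "new_multistep T k \<alpha> \<beta> x0 (Suc n) =
     (1 - \<alpha> n) *\<^sub>R new_multistep_inner T k (\<lambda>i. \<beta> i n) (new_multistep T k \<alpha> \<beta> x0 n) 1
     + \<alpha> n *\<^sub>R T (new_multistep_inner T k (\<lambda>i. \<beta> i n) (new_multistep T k \<alpha> \<beta> x0 n) 1)"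

definition ishikawa ::
  "('a::real_vector \<Rightarrow> 'a) \<Rightarrow> (nat \<Rightarrow> real) \<Rightarrow> (nat \<Rightarrow> nat \<Rightarrow> real) \<Rightarrow> 'a \<Rightarrow> nat \<Rightarrow> 'a" where
  "ishikawa T = multistep T 2"

definition noor ::
  "('a::real_vector \<Rightarrow> 'a) \<Rightarrow> (nat \<Rightarrow> real) \<Rightarrow> (nat \<Rightarrow> nat \<Rightarrow> real) \<Rightarrow> 'a \<Rightarrow> nat \<Rightarrow> 'a" where
  "noor T = multistep T 3"

definition new_two_step ::
  "('a::real_vector \<Rightarrow> 'a) \<Rightarrow> (nat \<Rightarrow> real) \<Rightarrow> (nat \<Rightarrow> nat \<Rightarrow> real) \<Rightarrow> 'a \<Rightarrow> nat \<Rightarrow> 'a" where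
  "new_two_step T = new_multistep T 2"

definition sp_iteration ::
  "('a::real_vector \<Rightarrow> 'a) \<Rightarrow> (nat \<Rightarrow> real) \<Rightarrow> (nat \<Rightarrow> nat \<Rightarrow> real) \<Rightarrow> 'a \<Rightarrow> nat \<Rightarrow> 'a" where
  "sp_iteration T = new_multistep T 3"

primrec s_iteration ::
  "('a::real_vector \<Rightarrow> 'a) \<Rightarrow> (nat \<Rightarrow> real) \<Rightarrow> (nat \<Rightarrow> real) \<Rightarrow> 'a \<Rightarrow> nat \<Rightarrow> 'a" where
  "s_iteration T \<alpha> \<beta> x0 0 = x0"
| "s_iteration T \<alpha> \<beta> x0 (Suc n) =
     (let x = s_iteration T \<alpha> \<beta> x0 n;
          y = (1 - \<beta> n) *\<^sub>R x + \<beta> n *\<^sub>R T x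
      in (1 - \<alpha> n) *\<^sub>R T x + \<alpha> n *\<^sub>R T y)"

lemma ishikawa_Suc:
  "ishikawa T \<alpha> \<beta> x0 (Suc n) =
     (let x = ishikawa T \<alpha> \<beta> x0 n;
          y = (1 - \<beta> 1 n) *\<^sub>R x + \<beta> 1 n *\<^sub>R T x
      in (1 - \<alpha> n) *\<^sub>R x + \<alpha> n *\<^sub>R T y)"
  by (simp add: ishikawa_def multistep_inner.simps Let_def)

lemma noor_Suc:
  "noor T \<alpha> \<beta> x0 (Suc n) =
     (let x = noor T \<alpha> \<beta> x0 n;
          y2 = (1 - \<beta> 2 n) *\<^sub>R x + \<beta> 2 n *\<^sub>R T x;
          y1 = (1 - \<beta> 1 n) *\<^sub>R x + \<beta> 1 n *\<^sub>R T y2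
      in (1 - \<alpha> n) *\<^sub>R x + \<alpha> n *\<^sub>R T y1)"
  by (simp add: noor_def multistep_inner.simps[of _ _ _ _ "Suc 0"]
      multistep_inner.simps[of _ _ _ _ 2] Let_def numeral_2_eq_2[symmetric])

lemma new_two_step_Suc:
  "new_two_step T \<alpha> \<beta> x0 (Suc n) =
     (let x = new_two_step T \<alpha> \<beta> x0 n;
          y = (1 - \<beta> 1 n) *\<^sub>R x + \<beta> 1 n *\<^sub>R T x
      in (1 - \<alpha> n) *\<^sub>R y + \<alpha> n *\<^sub>R T y)"
  by (simp add: new_two_step_def new_multistep_inner.simps Let_def)

lemma sp_iteration_Suc:
  "sp_iteration T \<alpha> \<beta> x0 (Suc n) =
     (let x = sp_iteration T \<alpha> \<beta> x0 n;
          y2 = (1 - \<beta> 2 n) *\<^sub>R x + \<beta> 2 n *\<^sub>R T x;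
          y1 = (1 - \<beta> 1 n) *\<^sub>R y2 + \<beta> 1 n *\<^sub>R T y2
      in (1 - \<alpha> n) *\<^sub>R y1 + \<alpha> n *\<^sub>R T y1)"
  by (simp add: sp_iteration_def new_multistep_inner.simps[of _ _ _ _ "Suc 0"]
      new_multistep_inner.simps[of _ _ _ _ 2] Let_def numeral_2_eq_2[symmetric])

end

theory Submission
  imports Defs
begin

text \<open>
  Choosing the fixed point \<open>p\<close> as the first argument of the contractive-like inequality
  annihilates the term with \<open>\<phi>\<close>, since \<open>p - T p = 0\<close> and \<open>\<phi> 0 = 0\<close>. What remains is
  \<open>\<parallel>T y - p\<parallel> \<le> \<delta> \<parallel>y - p\<parallel>\<close> for all \<open>y \<in> E\<close>: the map contracts distances to \<open>p\<close>.

  Each scheme forms its next iterate as \<open>(1 - a) u + a T v\<close> with a weight \<open>a\<close> bounded below by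
  a positive constant \<open>c\<close> that is the same for all steps, where \<open>u\<close> and \<open>v\<close> are
  points of \<open>E\<close> no farther from \<open>p\<close> than the current iterate (for Picard, \<open>a = 1\<close>). Hence the new distance to \<open>p\<close>
  is at most \<open>1 - c (1 - \<delta>) < 1\<close> times the old one (lemma \<open>relaxed_step\<close>), and the iteration
  converges geometrically (lemma \<open>converges\<close>). The inner points of the schemes are again of the
  form \<open>(1 - b) u + b T v\<close>, so they never move away from \<open>p\<close>, whatever \<open>b \<in> [0,1]\<close> is.

  So each of the ten iterations converges to \<open>p\<close>, and the equivalences hold because all ten
  statements are true.
\<close>

locale contraction_towards =
  fixes E :: "'a::real_normed_vector set" and T :: "'a \<Rightarrow> 'a" and p :: 'a and \<delta> :: real
  assumes convex_E: "convex E"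
    and maps: "x \<in> E \<Longrightarrow> T x \<in> E"
    and \<delta>_nonneg: "0 \<le> \<delta>" and \<delta>_less_1: "\<delta> < 1"
    and contracts: "x \<in> E \<Longrightarrow> norm (T x - p) \<le> \<delta> * norm (x - p)"
begin

text \<open>Membership in \<open>E\<close> and the distance bound are tracked together, because every estimate
  needs both; a step of an iteration then becomes an implication between memberships.\<close>

definition nearby :: "real \<Rightarrow> 'a set" where
  "nearby r = {x \<in> E. norm (x - p) \<le> r}"

lemma nearby_nonneg: "x \<in> nearby r \<Longrightarrow> 0 \<le> r"
  unfolding nearby_def using norm_ge_zero[of "x - p"] by (auto simp del: norm_ge_zero)

text \<open>Two points \<open>u\<close> and \<open>v\<close> are allowed because the schemes differ precisely in them:
  \<open>u\<close> is the iterate itself, an inner point, or an image under \<open>T\<close>. The part \<open>T v\<close> shrinks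
  by \<open>\<delta>\<close>, which gives the factor \<open>1 - a (1 - \<delta>)\<close>; replacing \<open>a\<close> by its lower bound
  \<open>c\<close> makes the factor the same at every step.\<close>

lemma relaxed_step:
  assumes u: "u \<in> nearby r" and v: "v \<in> nearby r" and a: "c \<le> a" "0 \<le> a" "a \<le> 1"
  shows "(1 - a) *\<^sub>R u + a *\<^sub>R T v \<in> nearby ((1 - c * (1 - \<delta>)) * r)"
proof -
  have r: "0 \<le> r" using u by (rule nearby_nonneg)
  have E: "(1 - a) *\<^sub>R u + a *\<^sub>R T v \<in> E"
    using convexD_alt[OF convex_E, of u "T v" a] maps u v a by (simp add: nearby_def)
  have "(1 - a) *\<^sub>R u + a *\<^sub>R T v - p = (1 - a) *\<^sub>R (u - p) + a *\<^sub>R (T v - p)"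
    by (simp add: algebra_simps)
  also have "norm \<dots> \<le> (1 - a) * norm (u - p) + a * norm (T v - p)"
    using a by (intro norm_triangle_le) simp
  also have "\<dots> \<le> (1 - a) * r + a * (\<delta> * r)"
  proof -
    have "norm (T v - p) \<le> \<delta> * norm (v - p)"
      using contracts v by (simp add: nearby_def)
    also have "\<dots> \<le> \<delta> * r"
      using v \<delta>_nonneg by (simp add: nearby_def mult_left_mono)
    finally show ?thesis
      using u a by (intro add_mono mult_left_mono) (auto simp: nearby_def)
  qed
  also have "\<dots> = (1 - a * (1 - \<delta>)) * r"
    by (simp add: algebra_simps)
  also have "\<dots> \<le> (1 - c * (1 - \<delta>)) * r"
    using a r \<delta>_less_1 by (intro mult_right_mono diff_left_mono) auto
  finally show ?thesis using E by (simp add: nearby_def)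
qed

text \<open>The inner weights have no positive lower bound, so for inner points only \<open>c = 0\<close> is
  available in \<open>relaxed_step\<close>, and the bound \<open>r\<close> is merely preserved.\<close>

lemma nearby_relaxed:
  assumes "u \<in> nearby r" "v \<in> nearby r" "0 \<le> b" "b \<le> 1"
  shows "(1 - b) *\<^sub>R u + b *\<^sub>R T v \<in> nearby r"
  using relaxed_step[of u r v 0 b] assms by simp

lemma nearby_T: "v \<in> nearby r \<Longrightarrow> T v \<in> nearby r"
  using nearby_relaxed[of v r v 1] by simp

lemma converges:
  assumes start: "x 0 \<in> E" and c: "0 < c" "c \<le> 1"
    and step: "\<And>n r. x n \<in> nearby r \<Longrightarrow> x (Suc n) \<in> nearby ((1 - c * (1 - \<delta>)) * r)"
  shows "x \<longlonglongrightarrow> p"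
proof -
  define q where "q = 1 - c * (1 - \<delta>)"
  have q: "0 \<le> q" "q < 1"
    using mult_mono[of c 1 "1 - \<delta>" 1] c \<delta>_nonneg \<delta>_less_1 by (simp_all add: q_def)
  have bound: "x n \<in> nearby (q ^ n * norm (x 0 - p))" for n
  proof (induction n)
    case 0
    then show ?case using start by (simp add: nearby_def)
  next
    case (Suc n)
    then show ?case using step[OF Suc] by (simp add: q_def mult.assoc)
  qed
  have "(\<lambda>n. q ^ n * norm (x 0 - p)) \<longlonglongrightarrow> 0"
    using q by (intro tendsto_mult_left_zero LIMSEQ_power_zero) simp
  then have "(\<lambda>n. x n - p) \<longlonglongrightarrow> 0"
    by (rule Lim_null_comparison[rotated]) (use bound in \<open>simp add: nearby_def\<close>)
  then show ?thesis by (simp add: LIM_zero_iff)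
qed

lemma picard_converges:
  assumes "x0 \<in> E"
  shows "picard T x0 \<longlonglongrightarrow> p"
proof (rule converges[where c = 1])
  show "picard T x0 (Suc n) \<in> nearby ((1 - 1 * (1 - \<delta>)) * r)" if "picard T x0 n \<in> nearby r" for n r
    using relaxed_step[OF that that, of 1 1] by simp
qed (use assms in auto)

lemma mann_converges:
  assumes "x0 \<in> E" "0 < c" "\<And>n. c \<le> \<alpha> n" "\<And>n. \<alpha> n \<le> 1"
  shows "mann T \<alpha> x0 \<longlonglongrightarrow> p"
proof (rule converges[where c = c])
  have "0 \<le> \<alpha> n" for n using assms(2) assms(3)[of n] by linarith
  then show "mann T \<alpha> x0 (Suc n) \<in> nearby ((1 - c * (1 - \<delta>)) * r)"
    if "mann T \<alpha> x0 n \<in> nearby r" for n r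
    using relaxed_step[OF that that] assms by simp
  show "c \<le> 1" using assms(3)[of 0] assms(4)[of 0] by linarith
qed (use assms in auto)

lemma krasnoselskij_eq_mann: "krasnoselskij T l x0 n = mann T (\<lambda>_. l) x0 n"
  by (induction n) simp_all

lemma krasnoselskij_converges:
  assumes "x0 \<in> E" "0 < l" "l \<le> 1"
  shows "krasnoselskij T l x0 \<longlonglongrightarrow> p"
  using mann_converges[of x0 l "\<lambda>_. l"] assms
  by (simp add: krasnoselskij_eq_mann[abs_def])

text \<open>Inner points are computed from superscript \<open>k - 1\<close> downwards, hence induction on
  \<open>k - i\<close>. Superscripts \<open>i \<ge> k - 1\<close> all fall into the base case.\<close>

lemma multistep_inner_nearby:
  assumes "x \<in> nearby r" "\<And>j. j \<ge> 1 \<Longrightarrow> 0 \<le> b j \<and> b j \<le> 1" "i \<ge> 1"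
  shows "multistep_inner T k b x i \<in> nearby r"
  using assms(3)
proof (induction "k - i" arbitrary: i rule: less_induct)
  case less
  show ?case
  proof (cases "i < k - 1")
    case True
    then have "multistep_inner T k b x (i + 1) \<in> nearby r"
      using less.hyps[of "i + 1"] by simp
    then show ?thesis
      using True assms less.prems
      by (subst multistep_inner.simps) (simp add: nearby_relaxed)
  next
    case False
    then show ?thesis
      using assms less.prems by (subst multistep_inner.simps) (simp add: nearby_relaxed)
  qed
qed

lemma new_multistep_inner_nearby:
  assumes "x \<in> nearby r" "\<And>j. j \<ge> 1 \<Longrightarrow> 0 \<le> b j \<and> b j \<le> 1" "i \<ge> 1"
  shows "new_multistep_inner T k b x i \<in> nearby r"
  using assms(3)
proof (induction "k - i" arbitrary: i rule: less_induct)
  case less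
  show ?case
  proof (cases "i < k - 1")
    case True
    then have "new_multistep_inner T k b x (i + 1) \<in> nearby r"
      using less.hyps[of "i + 1"] by simp
    then show ?thesis
      using True assms less.prems
      by (subst new_multistep_inner.simps) (simp add: nearby_relaxed)
  next
    case False
    then show ?thesis
      using assms less.prems by (subst new_multistep_inner.simps) (simp add: nearby_relaxed)
  qed
qed

lemma multistep_converges:
  assumes "x0 \<in> E" "0 < c" "\<And>n. c \<le> \<alpha> n" "\<And>n. \<alpha> n \<le> 1"
    and \<beta>: "\<And>i n. i \<ge> 1 \<Longrightarrow> 0 \<le> \<beta> i n \<and> \<beta> i n \<le> 1"
  shows "multistep T k \<alpha> \<beta> x0 \<longlonglongrightarrow> p"
proof (rule converges[where c = c])
  have "0 \<le> \<alpha> n" for n using assms(2) assms(3)[of n] by linarith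
  then show "multistep T k \<alpha> \<beta> x0 (Suc n) \<in> nearby ((1 - c * (1 - \<delta>)) * r)"
    if "multistep T k \<alpha> \<beta> x0 n \<in> nearby r" for n r
    using relaxed_step[OF that multistep_inner_nearby[OF that]] assms by simp
  show "c \<le> 1" using assms(3)[of 0] assms(4)[of 0] by linarith
qed (use assms in auto)

lemma new_multistep_converges:
  assumes "x0 \<in> E" "0 < c" "\<And>n. c \<le> \<alpha> n" "\<And>n. \<alpha> n \<le> 1"
    and \<beta>: "\<And>i n. i \<ge> 1 \<Longrightarrow> 0 \<le> \<beta> i n \<and> \<beta> i n \<le> 1"
  shows "new_multistep T k \<alpha> \<beta> x0 \<longlonglongrightarrow> p"
proof (rule converges[where c = c])
  have "0 \<le> \<alpha> n" for n using assms(2) assms(3)[of n] by linarith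
  then show "new_multistep T k \<alpha> \<beta> x0 (Suc n) \<in> nearby ((1 - c * (1 - \<delta>)) * r)"
    if "new_multistep T k \<alpha> \<beta> x0 n \<in> nearby r" for n r
    using relaxed_step[OF new_multistep_inner_nearby[OF that] new_multistep_inner_nearby[OF that]]
      assms by simp
  show "c \<le> 1" using assms(3)[of 0] assms(4)[of 0] by linarith
qed (use assms in auto)

lemma s_iteration_converges:
  assumes "x0 \<in> E" "0 < c" "\<And>n. c \<le> \<alpha> n" "\<And>n. \<alpha> n \<le> 1"
    and \<beta>: "\<And>n. 0 \<le> \<beta> n \<and> \<beta> n \<le> 1"
  shows "s_iteration T \<alpha> \<beta> x0 \<longlonglongrightarrow> p"
proof (rule converges[where c = c])
  have "0 \<le> \<alpha> n" for n using assms(2) assms(3)[of n] by linarith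
  then show "s_iteration T \<alpha> \<beta> x0 (Suc n) \<in> nearby ((1 - c * (1 - \<delta>)) * r)"
    if "s_iteration T \<alpha> \<beta> x0 n \<in> nearby r" for n r
    using relaxed_step[OF nearby_T[OF that] nearby_relaxed[OF that that]] assms
    by (simp add: Let_def)
  show "c \<le> 1" using assms(3)[of 0] assms(4)[of 0] by linarith
qed (use assms in auto)

end

lemma contractive_like_contraction_towards:
  assumes "convex E" "T \<in> E \<rightarrow> E" "contractive_like_on E T" "p \<in> fixed_points E T"
  obtains \<delta> where "contraction_towards E T p \<delta>"
proof -
  obtain \<delta> \<phi> where \<delta>: "\<delta> \<in> {0..<1}" and \<phi>0: "\<phi> 0 = 0"
    and contr: "\<forall>x\<in>E. \<forall>y\<in>E. norm (T x - T y) \<le> \<delta> * norm (x - y) + \<phi> (norm (x - T x))"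
    using assms(3) unfolding contractive_like_on_def by blast
  have p: "p \<in> E" "T p = p" using assms(4) by (simp_all add: fixed_points_def)
  \<comment> \<open>The inequality is not symmetric: \<open>p\<close> must be its first argument for \<open>\<phi>\<close> to vanish.\<close>
  have "norm (T y - p) \<le> \<delta> * norm (y - p)" if "y \<in> E" for y
    using contr[rule_format, OF p(1) that] p \<phi>0 by (simp add: norm_minus_commute)
  with \<delta> assms(1,2) have "contraction_towards E T p \<delta>"
    by unfold_locales (auto simp: Pi_iff)
  then show ?thesis by (rule that)
qed

theorem corollary2:
  fixes E :: "'a::banach set" and T :: "'a \<Rightarrow> 'a" and x0 p :: 'a
    and k :: nat and \<alpha> \<beta> :: "nat \<Rightarrow> real" and \<beta>s :: "nat \<Rightarrow> nat \<Rightarrow> real" and l A :: real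
  assumes "E \<noteq> {}" and "closed E" and "convex E"
    and "T \<in> E \<rightarrow> E" and "contractive_like_on E T"
    and "fixed_points E T \<noteq> {}" and "p \<in> fixed_points E T"
    and "k \<ge> 2"
    and "\<And>n. \<alpha> n \<in> {0..<1}"
    and "\<And>n. \<beta> n \<in> {0..<1}"
    and "\<And>i n. i \<ge> 1 \<Longrightarrow> \<beta>s i n \<in> {0..<1}"
    and "l \<in> {0<..<1}"
    and "A > 0" and "\<And>n. \<alpha> n \<ge> A"
    and "x0 \<in> E"
  shows "(picard T x0 \<longlonglongrightarrow> p \<longleftrightarrow> krasnoselskij T l x0 \<longlonglongrightarrow> p) \<and>
         (picard T x0 \<longlonglongrightarrow> p \<longleftrightarrow> mann T \<alpha> x0 \<longlonglongrightarrow> p) \<and>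
         (picard T x0 \<longlonglongrightarrow> p \<longleftrightarrow> ishikawa T \<alpha> \<beta>s x0 \<longlonglongrightarrow> p) \<and>
         (picard T x0 \<longlonglongrightarrow> p \<longleftrightarrow> new_two_step T \<alpha> \<beta>s x0 \<longlonglongrightarrow> p) \<and>
         (picard T x0 \<longlonglongrightarrow> p \<longleftrightarrow> noor T \<alpha> \<beta>s x0 \<longlonglongrightarrow> p) \<and>
         (picard T x0 \<longlonglongrightarrow> p \<longleftrightarrow> sp_iteration T \<alpha> \<beta>s x0 \<longlonglongrightarrow> p) \<and>
         (picard T x0 \<longlonglongrightarrow> p \<longleftrightarrow> multistep T k \<alpha> \<beta>s x0 \<longlonglongrightarrow> p) \<and>
         (picard T x0 \<longlonglongrightarrow> p \<longleftrightarrow> new_multistep T k \<alpha> \<beta>s x0 \<longlonglongrightarrow> p) \<and>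
         (picard T x0 \<longlonglongrightarrow> p \<longleftrightarrow> s_iteration T \<alpha> \<beta> x0 \<longlonglongrightarrow> p)"
proof -
  obtain \<delta> where "contraction_towards E T p \<delta>"
    using contractive_like_contraction_towards assms(3,4,5,7) by blast
  then interpret contraction_towards E T p \<delta> .
  have \<alpha>: "\<alpha> n \<le> 1" for n using assms(9)[of n] by simp
  have \<beta>: "0 \<le> \<beta> n \<and> \<beta> n \<le> 1" for n using assms(10)[of n] by simp
  have \<beta>s: "0 \<le> \<beta>s i n \<and> \<beta>s i n \<le> 1" if "i \<ge> 1" for i n using assms(11)[OF that, of n] by simp
  have l: "0 < l" "l \<le> 1" using assms(12) by simp_all
  note multi = multistep_converges[OF assms(15,13,14) \<alpha> \<beta>s]
    and new_multi = new_multistep_converges[OF assms(15,13,14) \<alpha> \<beta>s]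
  show ?thesis
    using picard_converges[OF assms(15)] krasnoselskij_converges[OF assms(15) l]
      mann_converges[OF assms(15,13,14) \<alpha>] multi new_multi
      s_iteration_converges[OF assms(15,13,14) \<alpha> \<beta>]
    by (simp add: ishikawa_def noor_def new_two_step_def sp_iteration_def)
qed

end
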